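(* Let $n\in\mathbb{N}$ be such that $2n/3\in 2\mathbb{N}$ (i.e. $2n/3$ is an even natural number) and $2n/3\geq 6$. Then there exists a simple graph $G=(V,E)$ with $|V|=n$ and $$\delta(G)=\frac{2|V|}{3}-2$$ that contains an edge $x\sim y$ whose Lin-Lu-Yau curvature satisfies $\kappa(x,y)<0$.
   Context: Graphs are simple: unweighted, undirected, without multiple edges or self-loops, with nonempty vertex set. Write $x\sim y$ if $x,y\in V$ are joined by an edge. The combinatorial graph distance is $d(x,y)=\inf\{n : x=x_0\sim x_1\sim\dots\sim x_n=y\}$ (with $\inf\emptyset=\infty$). The degree $d_x$ of a vertex $x$ is its number of neighbors, and $\delta(G)=\min_{x\in V} d_x$. For probability measures $\mu_1,\mu_2$ on $V$, the Wasserstein distance is $$W_1(\mu_1,\mu_2)=\inf_{\pi\in\Pi(\mu_1,\mu_2)}\sum_{x\in V}\sum_{y\in V} d(x,y)\,\pi(x,y),$$ where $\Pi(\mu_1,\mu_2)$ is the set of $\pi:V\times V\to[0,1]$ with $\sum_{y\in V}\pi(x,y)=\mu_1(x)$ for all $x$ and $\sum_{x\in V}\pi(x,y)=\mu_2(y)$ for all $y$ (with the convention $\infty\cdot 0=0$). For $\alpha\in[0,1]$ and a vertex $x$ with $d_x\ge 1$, let $\mu_x^\alpha$ be the probability measure on $V$ given by $\mu_x^\alpha(x)=\alpha$, $\mu_x^\alpha(y)=\frac{1-\alpha}{d_x}$ if $y\sim x$, and $\mu_x^\alpha(y)=0$ otherwise. For an edge $x\sim y$, the $\alpha$-Ollivier-Ricci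 curvature is $\kappa_\alpha(x,y)=1-W_1(\mu_x^\alpha,\mu_y^\alpha)$, and the Lin-Lu-Yau curvature is $$\kappa(x,y)=\lim_{\alpha\to 1}\frac{\kappa_\alpha(x,y)}{1-\alpha}$$ (limit as $\alpha\uparrow 1$, $\alpha<1$; this limit is known to exist). *)

theory Defs
  imports "HOL-Analysis.Analysis" "Graph_Theory.Graph_Theory"
begin

text \<open>
  A finite simple graph is a \<open>pair_graph\<close>: a finite, symmetric, loop-free digraph whose arcs are
  pairs of vertices. An undirected edge is represented by its two opposite arcs, so the number of
  neighbours of \<open>x\<close> is \<open>out_degree G x\<close> and adjacency is \<open>x \<rightarrow>\<^bsub>G\<^esub> y\<close>.
\<close>

definition min_degree :: "('a, 'b) pre_digraph \<Rightarrow> nat" where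
  "min_degree G = Min (out_degree G ` verts G)"

text \<open>Unit arc weights make the cost of a walk its length; the value is \<open>\<infinity>\<close> if there is no walk.\<close>

definition graph_dist :: "('a, 'b) pre_digraph \<Rightarrow> 'a \<Rightarrow> 'a \<Rightarrow> ereal" where
  "graph_dist G x y = wf_digraph.\<mu> G (\<lambda>_. 1) x y"

text \<open>
  Measures on the finite vertex set, and couplings of them, are given by their mass functions; only
  the values on vertices matter.
\<close>

definition couplings ::
  "('a, 'b) pre_digraph \<Rightarrow> ('a \<Rightarrow> real) \<Rightarrow> ('a \<Rightarrow> real) \<Rightarrow> ('a \<Rightarrow> 'a \<Rightarrow> real) set" where
  "couplings G \<mu>1 \<mu>2 =
    {\<pi>. (\<forall>x\<in>verts G. \<forall>y\<in>verts G. \<pi> x y \<in> {0..1}) \<and>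
        (\<forall>x\<in>verts G. (\<Sum>y\<in>verts G. \<pi> x y) = \<mu>1 x) \<and>
        (\<forall>y\<in>verts G. (\<Sum>x\<in>verts G. \<pi> x y) = \<mu>2 y)}"

text \<open>Multiplication on \<open>ereal\<close> satisfies \<open>\<infinity> * 0 = 0\<close>, as required here.\<close>

definition wasserstein ::
  "('a, 'b) pre_digraph \<Rightarrow> ('a \<Rightarrow> real) \<Rightarrow> ('a \<Rightarrow> real) \<Rightarrow> ereal" where
  "wasserstein G \<mu>1 \<mu>2 =
    (INF \<pi>\<in>couplings G \<mu>1 \<mu>2. \<Sum>x\<in>verts G. \<Sum>y\<in>verts G. graph_dist G x y * ereal (\<pi> x y))"

definition lazy_walk :: "('a, 'b) pre_digraph \<Rightarrow> real \<Rightarrow> 'a \<Rightarrow> 'a \<Rightarrow> real" where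
  "lazy_walk G \<alpha> x y =
    (if y = x then \<alpha>
     else if x \<rightarrow>\<^bsub>G\<^esub> y then (1 - \<alpha>) / real (out_degree G x)
     else 0)"

definition ollivier_curvature :: "('a, 'b) pre_digraph \<Rightarrow> real \<Rightarrow> 'a \<Rightarrow> 'a \<Rightarrow> ereal" where
  "ollivier_curvature G \<alpha> x y = 1 - wasserstein G (lazy_walk G \<alpha> x) (lazy_walk G \<alpha> y)"

text \<open>The limit exists, and is finite, for every edge of a finite simple graph.\<close>

definition lly_curvature :: "('a, 'b) pre_digraph \<Rightarrow> 'a \<Rightarrow> 'a \<Rightarrow> ereal" where
  "lly_curvature G x y =
    Lim (at_left 1) (\<lambda>\<alpha>::real. ollivier_curvature G \<alpha> x y / ereal (1 - \<alpha>))"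

end

theory Submission
  imports Defs
begin

text \<open>
  Let \<open>n = 3 m\<close>. Take two disjoint cliques of size \<open>m + 1\<close>, joined only by one edge between
  \<open>x\<close> in the first and \<open>y\<close> in the second, and an independent set of the remaining
  \<open>m - 2\<close> vertices, joined to all clique vertices, except that one of them is joined
  neither to \<open>x\<close> nor to \<open>y\<close>. Both \<open>x\<close> and \<open>y\<close> have the minimal degree \<open>2 m - 2\<close>, and their
  \<open>m\<close> private neighbours in the one clique have distance 2 from those in the other.
  Exchanging the cliques is an optimal transport: its cost is attained by a 1-Lipschitz potential
  with value 2 on the first clique, 1 on \<open>y\<close> and on the independent set, and 0 elsewhere.
  This gives \<open>W = 1 + (1 - \<alpha>) / (2 m - 2)\<close> for \<open>\<alpha>\<close> close to 1, so the curvature of the edge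
  is \<open>- 1 / (2 m - 2)\<close>.
\<close>

section \<open>Distance and transport\<close>

context wf_digraph
begin

text \<open>The drops of \<open>f\<close> telescope along any walk. Without a walk the infimum is
  infinite and the bound is trivial.\<close>

lemma graph_dist_ge_potential:
  fixes f :: "'a \<Rightarrow> real"
  assumes "\<And>e. e \<in> arcs G \<Longrightarrow> f (tail G e) - f (head G e) \<le> 1"
  shows "ereal (f u - f v) \<le> graph_dist G u v"
proof -
  have "awalk u p v \<Longrightarrow> f u - f v \<le> awalk_cost (\<lambda>_. 1) p" for p
  proof (induction p arbitrary: u)
    case Nil
    then show ?case by (simp add: awalk_Nil_iff)
  next
    case (Cons e p)
    then have "e \<in> arcs G" "u = tail G e" "awalk (head G e) p v"
      by (auto simp: awalk_Cons_iff)
    with Cons.IH[of "head G e"] assms[of e] show ?case by simp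
  qed
  then show ?thesis
    unfolding graph_dist_def \<mu>_def by (intro INF_greatest) simp
qed

lemma graph_dist_nonneg: "0 \<le> graph_dist G u v"
  using graph_dist_ge_potential[of "\<lambda>_. 0" u v] by (simp add: zero_ereal_def)

lemma graph_dist_refl:
  assumes "u \<in> verts G"
  shows "graph_dist G u u = 0"
  using min_cost_le_walk_cost[of u "[]" u "\<lambda>_. 1"] assms graph_dist_nonneg[of u u]
  by (simp add: graph_dist_def awalk_Nil_iff zero_ereal_def[symmetric])

lemma graph_dist_arc:
  assumes "u \<rightarrow>\<^bsub>G\<^esub> v"
  shows "graph_dist G u v \<le> 1"
proof -
  obtain e where "arc e (u, v)" using assms by (auto simp: arcs_ends_conv arc_def)
  then have "awalk u [e] v" by (auto simp: awalk_simps arc_def)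
  from min_cost_le_walk_cost[OF this, of "\<lambda>_. 1"] show ?thesis
    by (simp add: graph_dist_def one_ereal_def)
qed

lemma graph_dist_two_arcs:
  assumes "u \<rightarrow>\<^bsub>G\<^esub> z" "z \<rightarrow>\<^bsub>G\<^esub> v"
  shows "graph_dist G u v \<le> 2"
proof -
  obtain e e' where "arc e (u, z)" "arc e' (z, v)"
    using assms by (auto simp: arcs_ends_conv arc_def)
  then have "awalk u [e, e'] v" by (auto simp: awalk_simps arc_def)
  from min_cost_le_walk_cost[OF this, of "\<lambda>_. 1"] show ?thesis
    by (simp add: graph_dist_def)
qed

text \<open>The easy half of Kantorovich duality: by the marginal conditions, the left side is the
  integral of \<open>f x - f y\<close> against any coupling.\<close>

lemma wasserstein_ge_potential:
  fixes f :: "'a \<Rightarrow> real"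
  assumes lip: "\<And>e. e \<in> arcs G \<Longrightarrow> f (tail G e) - f (head G e) \<le> 1"
  shows "ereal ((\<Sum>x\<in>verts G. f x * \<mu>1 x) - (\<Sum>x\<in>verts G. f x * \<mu>2 x)) \<le> wasserstein G \<mu>1 \<mu>2"
  unfolding wasserstein_def
proof (rule INF_greatest)
  fix \<pi> assume \<pi>: "\<pi> \<in> couplings G \<mu>1 \<mu>2"
  then have nonneg: "0 \<le> \<pi> x y" if "x \<in> verts G" "y \<in> verts G" for x y
    using that by (auto simp: couplings_def)
  have "(\<Sum>x\<in>verts G. \<Sum>y\<in>verts G. (f x - f y) * \<pi> x y) =
      (\<Sum>x\<in>verts G. \<Sum>y\<in>verts G. f x * \<pi> x y) - (\<Sum>x\<in>verts G. \<Sum>y\<in>verts G. f y * \<pi> x y)"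
    by (simp add: left_diff_distrib sum_subtractf)
  also have "(\<Sum>x\<in>verts G. \<Sum>y\<in>verts G. f y * \<pi> x y) =
      (\<Sum>y\<in>verts G. \<Sum>x\<in>verts G. f y * \<pi> x y)"
    by (rule sum.swap)
  finally have "(\<Sum>x\<in>verts G. f x * \<mu>1 x) - (\<Sum>x\<in>verts G. f x * \<mu>2 x) =
      (\<Sum>x\<in>verts G. \<Sum>y\<in>verts G. (f x - f y) * \<pi> x y)"
    using \<pi> by (simp add: couplings_def flip: sum_distrib_left)
  also have "ereal \<dots> = (\<Sum>x\<in>verts G. \<Sum>y\<in>verts G. ereal (f x - f y) * ereal (\<pi> x y))"
    by simp
  also have "\<dots> \<le> (\<Sum>x\<in>verts G. \<Sum>y\<in>verts G. graph_dist G x y * ereal (\<pi> x y))"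
    by (intro sum_mono ereal_mult_right_mono graph_dist_ge_potential lip) (auto simp: nonneg)
  finally show "ereal ((\<Sum>x\<in>verts G. f x * \<mu>1 x) - (\<Sum>x\<in>verts G. f x * \<mu>2 x)) \<le>
      (\<Sum>x\<in>verts G. \<Sum>y\<in>verts G. graph_dist G x y * ereal (\<pi> x y))" .
qed

text \<open>
  The plan leaves the mass \<open>s\<close> in place and moves the mass \<open>w\<close> along \<open>\<phi>\<close>; the potential \<open>f\<close>
  certifies its optimality by complementary slackness.
\<close>

lemma wasserstein_involution:
  fixes f s w :: "'a \<Rightarrow> real"
  assumes fin: "finite (verts G)"
    and lip: "\<And>e. e \<in> arcs G \<Longrightarrow> f (tail G e) - f (head G e) \<le> 1"
    and \<phi>: "\<And>u. u \<in> verts G \<Longrightarrow> \<phi> u \<in> verts G \<and> \<phi> (\<phi> u) = u"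
    and s: "\<And>u. u \<in> verts G \<Longrightarrow> 0 \<le> s u"
    and w: "\<And>u. u \<in> verts G \<Longrightarrow> 0 \<le> w u"
    and le1: "\<And>u. u \<in> verts G \<Longrightarrow> s u + w u \<le> 1"
    and \<mu>1: "\<And>u. u \<in> verts G \<Longrightarrow> \<mu>1 u = s u + w u"
    and \<mu>2: "\<And>u. u \<in> verts G \<Longrightarrow> \<mu>2 u = s u + w (\<phi> u)"
    and slack: "\<And>u. u \<in> verts G \<Longrightarrow> w u \<noteq> 0 \<Longrightarrow> graph_dist G u (\<phi> u) \<le> ereal (f u - f (\<phi> u))"
  shows "wasserstein G \<mu>1 \<mu>2 = ereal (\<Sum>u\<in>verts G. (f u - f (\<phi> u)) * w u)"
proof (rule antisym)
  \<comment> \<open>Adding the two cases lets both masses land on the diagonal at a fixed point of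
    \<open>\<phi>\<close>.\<close>
  define \<pi> where "\<pi> x y = (if y = x then s x else 0) + (if y = \<phi> x then w x else 0)" for x y
  have flip: "y = \<phi> x \<longleftrightarrow> x = \<phi> y" if "x \<in> verts G" "y \<in> verts G" for x y
    using \<phi> that by metis
  have "(\<Sum>x\<in>verts G. \<pi> x y) = \<mu>2 y" if y: "y \<in> verts G" for y
  proof -
    have "(\<Sum>x\<in>verts G. \<pi> x y) =
        (\<Sum>x\<in>verts G. (if x = y then s x else 0) + (if x = \<phi> y then w x else 0))"
      using flip y by (intro sum.cong) (auto simp: \<pi>_def)
    then show ?thesis using fin y \<phi> by (simp add: sum.distrib \<mu>2)
  qed
  moreover have "(\<Sum>y\<in>verts G. \<pi> x y) = \<mu>1 x" if "x \<in> verts G" for x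
    using that fin \<phi> by (simp add: \<pi>_def sum.distrib \<mu>1)
  moreover have "\<pi> x y \<in> {0..1}" if "x \<in> verts G" for x y
    using s[OF that] w[OF that] le1[OF that] by (auto simp: \<pi>_def)
  ultimately have "\<pi> \<in> couplings G \<mu>1 \<mu>2" by (simp add: couplings_def)
  then have "wasserstein G \<mu>1 \<mu>2 \<le>
      (\<Sum>x\<in>verts G. \<Sum>y\<in>verts G. graph_dist G x y * ereal (\<pi> x y))"
    unfolding wasserstein_def by (rule INF_lower)
  also have "\<dots> \<le> (\<Sum>x\<in>verts G. ereal ((f x - f (\<phi> x)) * w x))"
  proof (rule sum_mono)
    fix x assume x: "x \<in> verts G"
    have "(\<Sum>y\<in>verts G. graph_dist G x y * ereal (\<pi> x y)) =
        (\<Sum>y\<in>verts G. (if y = x then graph_dist G x y * ereal (s x) else 0) +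
          (if y = \<phi> x then graph_dist G x y * ereal (w x) else 0))"
    proof (rule sum.cong)
      fix y
      have "ereal (\<pi> x y) =
          (if y = x then ereal (s x) else 0) + (if y = \<phi> x then ereal (w x) else 0)"
        by (simp add: \<pi>_def)
      then show "graph_dist G x y * ereal (\<pi> x y) =
          (if y = x then graph_dist G x y * ereal (s x) else 0) +
          (if y = \<phi> x then graph_dist G x y * ereal (w x) else 0)"
        using s[OF x] w[OF x] by (simp add: ereal_right_distrib)
    qed simp
    also have "\<dots> = graph_dist G x (\<phi> x) * ereal (w x)"
      using fin x \<phi> by (simp add: sum.distrib graph_dist_refl)
    also have "\<dots> \<le> ereal (f x - f (\<phi> x)) * ereal (w x)"
    \<comment> \<open>Slackness says nothing where no mass moves; there the cost is 0 even at
      infinite distance.\<close>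
    proof (cases "w x = 0")
      case True
      then show ?thesis by (simp flip: zero_ereal_def)
    next
      case False
      then show ?thesis using slack[OF x] w[OF x] by (intro ereal_mult_right_mono) auto
    qed
    finally show "(\<Sum>y\<in>verts G. graph_dist G x y * ereal (\<pi> x y)) \<le> ereal ((f x - f (\<phi> x)) * w x)"
      by simp
  qed
  finally show "wasserstein G \<mu>1 \<mu>2 \<le> ereal (\<Sum>u\<in>verts G. (f u - f (\<phi> u)) * w u)"
    by simp
next
  \<comment> \<open>Reindexing along the involution identifies the cost of the plan with the dual
    value of \<open>f\<close>.\<close>
  have "(\<Sum>u\<in>verts G. f u * w (\<phi> u)) = (\<Sum>u\<in>verts G. f (\<phi> u) * w u)"
    by (rule sum.reindex_bij_witness[of _ \<phi> \<phi>]) (auto simp: \<phi>)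
  then have "(\<Sum>u\<in>verts G. (f u - f (\<phi> u)) * w u) =
      (\<Sum>u\<in>verts G. f u * \<mu>1 u) - (\<Sum>u\<in>verts G. f u * \<mu>2 u)"
    by (simp add: \<mu>1 \<mu>2 left_diff_distrib distrib_left sum_subtractf sum.distrib)
  then show "ereal (\<Sum>u\<in>verts G. (f u - f (\<phi> u)) * w u) \<le> wasserstein G \<mu>1 \<mu>2"
    using wasserstein_ge_potential[of f \<mu>1 \<mu>2, OF lip] by simp
qed

end

text \<open>The quotient in the definition is constantly \<open>- c\<close> near 1, which settles
  the limit.\<close>

lemma lly_curvature_eqI:
  assumes "\<forall>\<^sub>F \<alpha> in at_left 1.
    wasserstein G (lazy_walk G \<alpha> x) (lazy_walk G \<alpha> y) = ereal (1 + c * (1 - \<alpha>))"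
  shows "lly_curvature G x y = ereal (- c)"
proof -
  have "\<forall>\<^sub>F \<alpha> :: real in at_left 1. \<alpha> < 1" by (auto simp: eventually_at_left_field intro: exI[of _ 0])
  with assms have "\<forall>\<^sub>F \<alpha> in at_left 1.
      ereal (- c) = ollivier_curvature G \<alpha> x y / ereal (1 - \<alpha>)"
  proof eventually_elim
    case (elim \<alpha>)
    then have "ollivier_curvature G \<alpha> x y = ereal (- c * (1 - \<alpha>))"
      by (simp add: ollivier_curvature_def one_ereal_def)
    with elim show ?case by simp
  qed
  then have "((\<lambda>\<alpha>. ollivier_curvature G \<alpha> x y / ereal (1 - \<alpha>)) \<longlongrightarrow> ereal (- c)) (at_left 1)"
    by (rule Lim_transform_eventually[OF tendsto_const])
  then show ?thesis
    unfolding lly_curvature_def by (intro tendsto_Lim) simp_all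
qed

lemma out_degree_with_proj: "out_degree (with_proj G) u = card {v. (u, v) \<in> parcs G}"
proof -
  have "out_arcs (with_proj G) u = Pair u ` {v. (u, v) \<in> parcs G}" by auto
  then show ?thesis by (simp add: out_degree_def card_image inj_on_def)
qed

section \<open>The extremal graph\<close>

text \<open>
  The cliques are \<open>{0..m}\<close> and \<open>{m+1..2m+1}\<close>, with \<open>x = 0\<close> and \<open>y = m + 1\<close>; the
  exceptional vertex of the independent set \<open>{2m+2..<3m}\<close> is \<open>2m + 2\<close>.
\<close>

definition cross_adj :: "nat \<Rightarrow> nat \<Rightarrow> nat \<Rightarrow> bool" where
  "cross_adj m u v \<longleftrightarrow>
    u = 0 \<and> v = m + 1 \<or>
    u \<le> 2 * m + 1 \<and> 2 * m + 1 < v \<and> \<not> (v = 2 * m + 2 \<and> (u = 0 \<or> u = m + 1))"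

text \<open>\<open>cross_adj\<close> lists each edge between different parts once, from its smaller
  end; taking both orientations gives symmetry.\<close>

definition adj :: "nat \<Rightarrow> nat \<Rightarrow> nat \<Rightarrow> bool" where
  "adj m u v \<longleftrightarrow> u \<noteq> v \<and>
    (u \<le> m \<and> v \<le> m \<or> u \<in> {m+1..2*m+1} \<and> v \<in> {m+1..2*m+1} \<or> cross_adj m u v \<or> cross_adj m v u)"

definition two_clique_graph :: "nat \<Rightarrow> nat pair_pre_digraph" where
  "two_clique_graph m =
    \<lparr> pverts = {..<3 * m}, parcs = {(u, v). u < 3 * m \<and> v < 3 * m \<and> adj m u v} \<rparr>"

lemma two_clique_graph_simps [simp]:
  "pverts (two_clique_graph m) = {..<3 * m}"
  "(u, v) \<in> parcs (two_clique_graph m) \<longleftrightarrow> u < 3 * m \<and> v < 3 * m \<and> adj m u v"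
  by (auto simp: two_clique_graph_def)

lemma pair_graph_two_clique_graph: "pair_graph (two_clique_graph m)"
proof
  show "finite (parcs (two_clique_graph m))"
    by (rule finite_subset[of _ "{..<3 * m} \<times> {..<3 * m}"]) auto
  show "symmetric (with_proj (two_clique_graph m))"
    by (auto simp: symmetric_def sym_def adj_def)
qed (auto simp: adj_def)

context
  fixes m :: nat
  assumes m: "m \<ge> 3"
begin

lemma out_degree_endpoints:
  assumes "u = 0 \<or> u = m + 1"
  shows "out_degree (two_clique_graph m) u = 2 * m - 2"
proof -
  \<comment> \<open>The \<open>m\<close> clique neighbours and the opposite endpoint; only the
    \<open>m - 3\<close> non-exceptional independent vertices are added below.\<close>
  let ?K = "if u = 0 then {1..m+1} else insert 0 {m+2..2*m+1}"
  have "{v. (u, v) \<in> parcs (two_clique_graph m)} = ?K \<union> {2*m+3..<3*m}"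
    using assms m by (auto simp: adj_def cross_adj_def)
  also have "card \<dots> = card ?K + card {2*m+3..<3*m}"
    by (rule card_Un_disjoint) auto
  also have "card ?K = m + 1" by simp
  finally show ?thesis using m by (simp add: out_degree_with_proj)
qed

text \<open>A clique vertex other than the endpoints has \<open>m\<close> neighbours in its clique
  and \<open>m - 2\<close> independent ones; an independent vertex has at least
  \<open>2 * m\<close>.\<close>

lemma out_degree_ge:
  assumes "u < 3 * m"
  shows "2 * m - 2 \<le> out_degree (two_clique_graph m) u"
proof -
  let ?N = "{v. (u, v) \<in> parcs (two_clique_graph m)}"
  have fin: "finite ?N" by (rule finite_subset[of _ "{..<3 * m}"]) auto
  consider "u = 0 \<or> u = m + 1" | "1 \<le> u" "u \<le> m" | "m + 2 \<le> u" "u \<le> 2 * m + 1"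
    | "2 * m + 2 \<le> u"
    by linarith
  then have "2 * m - 2 \<le> card ?N"
  proof cases
    case 1
    then show ?thesis unfolding out_degree_with_proj[symmetric] by (simp only: out_degree_endpoints)
  next
    case 2
    then have "({..m} - {u}) \<union> {2*m+2..<3*m} \<subseteq> ?N"
      using m by (auto simp: adj_def cross_adj_def)
    with fin have "card (({..m} - {u}) \<union> {2*m+2..<3*m}) \<le> card ?N" by (intro card_mono)
    also have "card (({..m} - {u}) \<union> {2*m+2..<3*m}) = card ({..m} - {u}) + card {2*m+2..<3*m}"
      by (rule card_Un_disjoint) auto
    finally show ?thesis using 2 m by simp
  next
    case 3
    then have "({m+1..2*m+1} - {u}) \<union> {2*m+2..<3*m} \<subseteq> ?N"
      using m by (auto simp: adj_def cross_adj_def)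
    with fin have "card (({m+1..2*m+1} - {u}) \<union> {2*m+2..<3*m}) \<le> card ?N" by (intro card_mono)
    also have "card (({m+1..2*m+1} - {u}) \<union> {2*m+2..<3*m}) =
        card ({m+1..2*m+1} - {u}) + card {2*m+2..<3*m}"
      by (rule card_Un_disjoint) auto
    finally show ?thesis using 3 m by simp
  next
    case 4
    \<comment> \<open>Leaving out both endpoints makes this hold for the exceptional vertex
      too.\<close>
    then have "{1..m} \<union> {m+2..2*m+1} \<subseteq> ?N"
      using m assms by (auto simp: adj_def cross_adj_def)
    with fin have "card ({1..m} \<union> {m+2..2*m+1}) \<le> card ?N" by (intro card_mono)
    also have "card ({1..m} \<union> {m+2..2*m+1}) = card {1..m} + card {m+2..2*m+1}"
      by (rule card_Un_disjoint) auto
    finally show ?thesis by simp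
  qed
  then show ?thesis by (simp add: out_degree_with_proj)
qed

lemma min_degree_two_clique_graph: "min_degree (two_clique_graph m) = 2 * m - 2"
  unfolding min_degree_def
proof (rule Min_eqI)
  have "0 \<in> verts (two_clique_graph m)" using m by simp
  then show "2 * m - 2 \<in> out_degree (two_clique_graph m) ` verts (two_clique_graph m)"
    using out_degree_endpoints[of 0] by (metis imageI)
qed (auto intro: out_degree_ge)

text \<open>The lower bound on \<open>\<alpha>\<close> says that each endpoint keeps at least the
  mass \<open>t\<close> it receives from the other's walk, so that \<open>\<alpha> - t\<close> can
  be moved.\<close>

lemma wasserstein_two_clique_graph:
  assumes \<alpha>: "1 / (2 * real m - 1) \<le> \<alpha>" "\<alpha> < 1"
  shows "wasserstein (two_clique_graph m)
      (lazy_walk (two_clique_graph m) \<alpha> 0) (lazy_walk (two_clique_graph m) \<alpha> (m + 1)) =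
    ereal (1 + 1 / (2 * real m - 2) * (1 - \<alpha>))"
proof -
  let ?G = "two_clique_graph m"
  interpret wf_digraph "with_proj ?G"
    by (simp add: wf_digraph_wp_iff pair_graph_two_clique_graph pair_graph.axioms(1)
      pair_digraph.pair_wf_digraph)
  define t where "t = (1 - \<alpha>) / (2 * real m - 2)"
  define f :: "nat \<Rightarrow> real" where
    "f u = (if u \<le> m then 2 else if m + 1 < u \<and> u \<le> 2 * m + 1 then 0 else 1)" for u
  define \<phi> where
    "\<phi> u = (if u \<le> m then u + (m + 1) else if u \<le> 2 * m + 1 then u - (m + 1) else u)" for u
  \<comment> \<open>The pointwise minimum of the two measures: the endpoints and their common
    neighbours share mass \<open>t\<close>.\<close>
  define s where "s u = (if u = 0 \<or> u = m + 1 \<or> 2 * m + 2 < u then t else 0)" for u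
  define w where "w u = (if u = 0 then \<alpha> - t else if u \<le> m then t else 0)" for u
  have t: "0 \<le> t" "t \<le> \<alpha>" "\<alpha> + (2 * real m - 2) * t = 1"
    using \<alpha> m by (auto simp: t_def field_simps)
  have deg: "real (out_degree ?G 0) = 2 * real m - 2" "real (out_degree ?G (m + 1)) = 2 * real m - 2"
    using m by (simp_all add: out_degree_endpoints)
  have "wasserstein ?G (lazy_walk ?G \<alpha> 0) (lazy_walk ?G \<alpha> (m + 1)) =
      ereal (\<Sum>u\<in>verts ?G. (f u - f (\<phi> u)) * w u)"
  proof (rule wasserstein_involution[where s = s])
    fix u assume u: "u \<in> verts ?G"
    show "\<phi> u \<in> verts ?G \<and> \<phi> (\<phi> u) = u" using u m by (auto simp: \<phi>_def)
    show "0 \<le> s u" "0 \<le> w u" "s u + w u \<le> 1" using t \<alpha> by (auto simp: s_def w_def)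
    show "lazy_walk ?G \<alpha> 0 u = s u + w u" using u m deg
      by (auto simp: lazy_walk_def s_def w_def adj_def cross_adj_def t_def)
    show "lazy_walk ?G \<alpha> (m + 1) u = s u + w (\<phi> u)" using u m deg
      by (auto simp: lazy_walk_def s_def w_def \<phi>_def adj_def cross_adj_def t_def)
    assume "w u \<noteq> 0"
    then consider "u = 0" | "1 \<le> u" "u \<le> m" by (auto simp: w_def split: if_splits)
    then show "graph_dist ?G u (\<phi> u) \<le> ereal (f u - f (\<phi> u))"
    proof cases
      case 1
      then have "graph_dist ?G u (\<phi> u) \<le> 1"
        using m by (intro graph_dist_arc) (auto simp: \<phi>_def adj_def cross_adj_def)
      with 1 show ?thesis by (simp add: f_def \<phi>_def one_ereal_def)
    next
      case 2
      \<comment> \<open>The exceptional vertex is a midpoint, being adjacent to all clique vertices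
        but the endpoints.\<close>
      then have "graph_dist ?G u (\<phi> u) \<le> 2"
        using m by (intro graph_dist_two_arcs[of _ "2 * m + 2"])
          (auto simp: \<phi>_def adj_def cross_adj_def)
      with 2 show ?thesis by (simp add: f_def \<phi>_def)
    qed
  next
    \<comment> \<open>The only arc from the first clique to the second ends at \<open>m + 1\<close>,
      where \<open>f\<close> is 1, so no arc drops by 2.\<close>
    fix e assume "e \<in> arcs ?G"
    then show "f (tail ?G e) - f (head ?G e) \<le> 1"
      by (cases e) (auto simp: f_def adj_def cross_adj_def split: if_splits)
  qed simp
  also have "(\<Sum>u\<in>verts ?G. (f u - f (\<phi> u)) * w u) = (\<Sum>u\<le>m. (f u - f (\<phi> u)) * w u)"
    using m by (intro sum.mono_neutral_right) (auto simp: w_def)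
  also have "\<dots> = (f 0 - f (\<phi> 0)) * w 0 + (\<Sum>u\<in>{1..m}. (f u - f (\<phi> u)) * w u)"
    by (simp add: atMost_atLeast0 sum.atLeast_Suc_atMost)
  also have "(\<Sum>u\<in>{1..m}. (f u - f (\<phi> u)) * w u) = (\<Sum>u\<in>{1..m}. 2 * t)"
    by (intro sum.cong) (auto simp: f_def \<phi>_def w_def)
  \<comment> \<open>The cost is \<open>\<alpha> - t + 2 * m * t\<close>, and the total mass
    \<open>\<alpha> + (2 * m - 2) * t\<close> is 1.\<close>
  also have "(f 0 - f (\<phi> 0)) * w 0 + (\<Sum>u\<in>{1..m}. 2 * t) = 1 + t"
    using t by (simp add: f_def \<phi>_def w_def algebra_simps)
  finally show ?thesis by (simp add: t_def)
qed

lemma lly_curvature_two_clique_graph: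
  "lly_curvature (two_clique_graph m) 0 (m + 1) = ereal (- (1 / (2 * real m - 2)))"
proof (rule lly_curvature_eqI)
  have "1 / (2 * real m - 1) < 1" using m by simp
  then have "\<forall>\<^sub>F \<alpha> in at_left 1. 1 / (2 * real m - 1) \<le> \<alpha> \<and> \<alpha> < 1"
    by (auto simp: eventually_at_left_field intro!: exI[of _ "1 / (2 * real m - 1)"])
  then show "\<forall>\<^sub>F \<alpha> in at_left 1. wasserstein (two_clique_graph m)
      (lazy_walk (two_clique_graph m) \<alpha> 0) (lazy_walk (two_clique_graph m) \<alpha> (m + 1)) =
    ereal (1 + 1 / (2 * real m - 2) * (1 - \<alpha>))"
    by eventually_elim (simp only: wasserstein_two_clique_graph)
qed

end

theorem theorem1p2:
  fixes n :: nat
  assumes "\<exists>m::nat. 2 * real n / 3 = real (2 * m)"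
    and "2 * real n / 3 \<ge> 6"
  shows "\<exists>G :: nat pair_pre_digraph.
           pair_graph G \<and> card (verts G) = n \<and>
           real (min_degree G) = 2 * real (card (verts G)) / 3 - 2 \<and>
           (\<exists>x y. x \<rightarrow>\<^bsub>G\<^esub> y \<and> lly_curvature G x y < 0)"
proof -
  obtain m where "2 * real n / 3 = real (2 * m)" using assms(1) by blast
  \<comment> \<open>The bound \<open>m \<ge> 3\<close> is what places the exceptional vertex
    \<open>2 * m + 2\<close> below \<open>3 * m\<close>.\<close>
  with assms(2) have n: "n = 3 * m" and m: "m \<ge> 3" by linarith+
  have "0 \<rightarrow>\<^bsub>two_clique_graph m\<^esub> (m + 1)" using m by (auto simp: adj_def cross_adj_def)
  moreover have "lly_curvature (two_clique_graph m) 0 (m + 1) < 0"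
    unfolding lly_curvature_two_clique_graph[OF m] using m by simp
  moreover have "card (verts (two_clique_graph m)) = n" using n by simp
  moreover from this have
    "real (min_degree (two_clique_graph m)) = 2 * real (card (verts (two_clique_graph m))) / 3 - 2"
    using m n by (simp add: min_degree_two_clique_graph)
  ultimately show ?thesis using pair_graph_two_clique_graph by blast
qed

end
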